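(* Let $M\subset\mathbb{C}$ be a simply connected domain and let $\Phi\colon M\to\mathbb{H}_{\mathbb{C}}$ be holomorphic with $\Phi(z)^s=0$ and $\Phi(z)\neq 0$ for every $z\in M$. Fix a non-zero null element $L_0\in\mathbb{H}_{\mathbb{C}}$ (i.e. $L_0\ne 0$, $L_0^s=0$). Then there exist holomorphic maps $A,B\colon M\to \operatorname{Sp}(1,\mathbb{C})$ such that $\Phi=A\,L_0\,B$ on $M$.
   Context: $\mathbb{H}_{\mathbb{C}}:=\mathbb{H}\otimes_{\mathbb{R}}\mathbb{C}$ is the algebra of complex quaternions: elements $q=q_0+q_1e_1+q_2e_2+q_3e_3$ with $q_j\in\mathbb{C}$, where the imaginary unit $\mathrm{i}\in\mathbb{C}$ commutes with $e_1,e_2,e_3$, and $e_1^2=e_2^2=e_3^2=-1$, $e_1e_2=e_3=-e_2e_1$, $e_2e_3=e_1=-e_3e_2$, $e_3e_1=e_2=-e_1e_3$. The conjugate is $q^c:=q_0-q_1e_1-q_2e_2-q_3e_3$ and the symmetrised norm is $q^s:=qq^c=q_0^2+q_1^2+q_2^2+q_3^2\in\mathbb{C}$. $\operatorname{Sp}(1,\mathbb{C}):=\{q\in\mathbb{H}_{\mathbb{C}}: q^s=1\}$. A map into $\mathbb{H}_{\mathbb{C}}$ is holomorphic if its four components are holomorphic. *)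

theory Defs
  imports "HOL-Complex_Analysis.Complex_Analysis"
begin

(* CQuat q0 q1 q2 q3 stands for q0 + q1 e1 + q2 e2 + q3 e3 with complex coefficients, so that
   the imaginary unit of complex is central and distinct from e1, e2, e3. *)
datatype cquat = CQuat (cq0: complex) (cq1: complex) (cq2: complex) (cq3: complex)

lemma cquat_eq_iff:
  "p = q \<longleftrightarrow> cq0 p = cq0 q \<and> cq1 p = cq1 q \<and> cq2 p = cq2 q \<and> cq3 p = cq3 q"
  by (cases p; cases q) auto

instantiation cquat :: ring_1
begin

definition zero_cquat :: cquat where
  "0 = CQuat 0 0 0 0"

definition one_cquat :: cquat where
  "1 = CQuat 1 0 0 0"

definition plus_cquat :: "cquat \<Rightarrow> cquat \<Rightarrow> cquat" where
  "p + q = CQuat (cq0 p + cq0 q) (cq1 p + cq1 q) (cq2 p + cq2 q) (cq3 p + cq3 q)"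

definition minus_cquat :: "cquat \<Rightarrow> cquat \<Rightarrow> cquat" where
  "p - q = CQuat (cq0 p - cq0 q) (cq1 p - cq1 q) (cq2 p - cq2 q) (cq3 p - cq3 q)"

definition uminus_cquat :: "cquat \<Rightarrow> cquat" where
  "- q = CQuat (- cq0 q) (- cq1 q) (- cq2 q) (- cq3 q)"

(* The complex-bilinear product determined by the table cq_unit_mult below. *)
definition times_cquat :: "cquat \<Rightarrow> cquat \<Rightarrow> cquat" where
  "p * q = CQuat
     (cq0 p * cq0 q - cq1 p * cq1 q - cq2 p * cq2 q - cq3 p * cq3 q)
     (cq0 p * cq1 q + cq1 p * cq0 q + cq2 p * cq3 q - cq3 p * cq2 q)
     (cq0 p * cq2 q - cq1 p * cq3 q + cq2 p * cq0 q + cq3 p * cq1 q)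
     (cq0 p * cq3 q + cq1 p * cq2 q - cq2 p * cq1 q + cq3 p * cq0 q)"

instance
  by standard
    (simp_all add: cquat_eq_iff zero_cquat_def one_cquat_def plus_cquat_def minus_cquat_def
      uminus_cquat_def times_cquat_def algebra_simps)

end

lemmas cquat_ring_defs =
  zero_cquat_def one_cquat_def plus_cquat_def minus_cquat_def uminus_cquat_def times_cquat_def

definition cq_of_complex :: "complex \<Rightarrow> cquat" where
  "cq_of_complex c = CQuat c 0 0 0"

definition cq_e1 :: cquat where "cq_e1 = CQuat 0 1 0 0"
definition cq_e2 :: cquat where "cq_e2 = CQuat 0 0 1 0"
definition cq_e3 :: cquat where "cq_e3 = CQuat 0 0 0 1"

lemmas cq_basis_defs = cq_of_complex_def cq_e1_def cq_e2_def cq_e3_def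

lemma cquat_expand:
  "q = cq_of_complex (cq0 q) + cq_of_complex (cq1 q) * cq_e1
     + cq_of_complex (cq2 q) * cq_e2 + cq_of_complex (cq3 q) * cq_e3"
  by (simp add: cquat_eq_iff cquat_ring_defs cq_basis_defs)

lemma cq_unit_mult:
  "cq_e1 * cq_e1 = -1" "cq_e2 * cq_e2 = -1" "cq_e3 * cq_e3 = -1"
  "cq_e1 * cq_e2 = cq_e3" "cq_e2 * cq_e1 = - cq_e3"
  "cq_e2 * cq_e3 = cq_e1" "cq_e3 * cq_e2 = - cq_e1"
  "cq_e3 * cq_e1 = cq_e2" "cq_e1 * cq_e3 = - cq_e2"
  by (simp_all add: cquat_eq_iff cquat_ring_defs cq_basis_defs)

lemma cq_of_complex_ring_hom:
  "cq_of_complex 0 = 0" "cq_of_complex 1 = 1"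
  "cq_of_complex (a + b) = cq_of_complex a + cq_of_complex b"
  "cq_of_complex (a * b) = cq_of_complex a * cq_of_complex b"
  by (simp_all add: cquat_eq_iff cquat_ring_defs cq_basis_defs)

lemma cq_of_complex_central: "cq_of_complex c * q = q * cq_of_complex c"
  by (simp add: cquat_eq_iff cquat_ring_defs cq_basis_defs)

(* Quaternionic conjugation; the complex coefficients are not conjugated. *)
definition cq_conj :: "cquat \<Rightarrow> cquat" where
  "cq_conj q = CQuat (cq0 q) (- cq1 q) (- cq2 q) (- cq3 q)"

(* The symmetrised norm, kept as an element of the algebra; cq_symnorm_eq shows that it lies in
   the centre, with complex value q0^2 + q1^2 + q2^2 + q3^2. *)
definition cq_symnorm :: "cquat \<Rightarrow> cquat" where
  "cq_symnorm q = q * cq_conj q"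

lemma cq_symnorm_eq:
  "cq_symnorm q = cq_of_complex ((cq0 q)\<^sup>2 + (cq1 q)\<^sup>2 + (cq2 q)\<^sup>2 + (cq3 q)\<^sup>2)"
  by (simp add: cq_symnorm_def cq_conj_def cquat_eq_iff cquat_ring_defs cq_basis_defs
      power2_eq_square algebra_simps)

definition Sp1C :: "cquat set" where
  "Sp1C = {q. cq_symnorm q = 1}"

definition cq_holomorphic_on :: "(complex \<Rightarrow> cquat) \<Rightarrow> complex set \<Rightarrow> bool"
    (infixl "cq'_holomorphic'_on" 50) where
  "f cq_holomorphic_on S \<longleftrightarrow>
     (\<lambda>z. cq0 (f z)) holomorphic_on S \<and> (\<lambda>z. cq1 (f z)) holomorphic_on S \<and>
     (\<lambda>z. cq2 (f z)) holomorphic_on S \<and> (\<lambda>z. cq3 (f z)) holomorphic_on S"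

end

theory Submission
  imports Defs
begin

text \<open>
  Complex quaternions are the complex 2x2 matrices, with the symmetrised norm as determinant, so
  the map is a holomorphic matrix of rank one everywhere, and the task is to write it as
  \<open>u v\<^sup>T\<close> with nowhere vanishing columns \<open>u\<close>, \<open>v\<close> and to complete both to matrices of determinant one.
  Both steps follow from the fact that two holomorphic functions on the domain, not both
  identically zero, have a greatest common divisor that is a linear combination of them. By the
  Riemann mapping theorem the domain is the plane or the unit disc, an increasing union of
  discs. On each disc one of the functions has finitely many zeros, which are split off one at a
  time. The solutions on the discs differ by units and by multiples of the syzygy, and these
  discrepancies are additive cocycles once logarithms of the units are taken; they are removed by
  Taylor approximation and a telescoping series.
\<close>

section \<open>Cancellation and division of holomorphic functions\<close>

text \<open>The non-zero set of \<open>h\<close> is open and contains \<open>w\<close>, so it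
  accumulates at \<open>w\<close>, and the identity theorem extends the cancelled equation from it
  to \<open>S\<close>.\<close>

lemma holomorphic_cancel_left:
  fixes f g h :: "complex \<Rightarrow> complex"
  assumes "open S" "connected S"
    and f: "f holomorphic_on S" and g: "g holomorphic_on S" and h: "h holomorphic_on S"
    and w: "w \<in> S" "h w \<noteq> 0"
    and eq: "\<And>z. z \<in> S \<Longrightarrow> h z * f z = h z * g z"
    and z: "z \<in> S"
  shows "f z = g z"
proof -
  define U where "U = {z\<in>S. h z \<noteq> 0}"
  have "open (S \<inter> h -` (- {0}))"
    using h \<open>open S\<close> by (intro continuous_open_preimage holomorphic_on_imp_continuous_on) auto
  also have "S \<inter> h -` (- {0}) = U"
    by (auto simp: U_def)
  finally have "open U" .
  moreover have "w \<in> U" using w by (simp add: U_def)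
  ultimately have "w islimpt U"
    by (simp add: islimpt_UNIV interior_limit_point interior_open)
  moreover have "(\<lambda>z. f z - g z) holomorphic_on S"
    by (intro holomorphic_intros f g)
  moreover have "f z - g z = 0" if "z \<in> U" for z
    using eq that by (auto simp: U_def)
  ultimately have "f z - g z = 0"
    using analytic_continuation[of "\<lambda>z. f z - g z" S U w z] assms(1,2) w z
    by (auto simp: U_def)
  then show ?thesis by simp
qed

text \<open>As \<open>f\<close> is not identically zero on the connected set \<open>S\<close>, a
  zero at \<open>s\<close> has finite order; the local factor near \<open>s\<close> and the quotient
  by the power of \<open>z - s\<close> elsewhere patch together. The exponent 0 covers the case of
  no zero at \<open>s\<close>.\<close>

lemma holomorphic_factor_out_zero:
  fixes f :: "complex \<Rightarrow> complex"
  assumes f: "f holomorphic_on S" and S: "open S" "connected S" and s: "s \<in> S"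
    and w: "w \<in> S" "f w \<noteq> 0"
  obtains n g where "g holomorphic_on S" "g s \<noteq> 0" "\<And>z. z \<in> S \<Longrightarrow> f z = (z - s) ^ n * g z"
proof (cases "f s = 0")
  case False
  then show ?thesis using that[of f 0] f by simp
next
  case True
  then have "\<not> f constant_on S"
    using w s by (force simp: constant_on_def)
  then obtain g r n where r: "0 < n" "0 < r" "ball s r \<subseteq> S"
    and g: "g holomorphic_on ball s r" "\<And>z. z \<in> ball s r \<Longrightarrow> f z = (z - s)^n * g z"
      "\<And>z. z \<in> ball s r \<Longrightarrow> g z \<noteq> 0"
    using holomorphic_factor_zero_nonconstant[OF f S s True] by metis
  define G where "G z = (if z = s then g s else f z / (z - s) ^ n)" for z
  have "G holomorphic_on ball s r"
    using g(1) by (rule holomorphic_transform) (auto simp: G_def g(2))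
  moreover have "G holomorphic_on S - {s}"
  proof (rule holomorphic_transform)
    show "(\<lambda>z. f z / (z - s) ^ n) holomorphic_on S - {s}"
      by (intro holomorphic_intros holomorphic_on_subset[OF f]) auto
  qed (auto simp: G_def)
  ultimately have "G holomorphic_on ball s r \<union> (S - {s})"
    using S by (intro holomorphic_on_Un) auto
  then have "G holomorphic_on S"
    by (rule holomorphic_on_subset) (use r in auto)
  moreover have "G s \<noteq> 0" using g(3)[of s] r by (simp add: G_def)
  moreover have "f z = (z - s) ^ n * G z" if "z \<in> S" for z
    using True r by (auto simp: G_def)
  ultimately show ?thesis using that by blast
qed

section \<open>Bezout identities when one function has finitely many zeros\<close>

text \<open>The identity is stated for the cofactors, so that it excludes their common zeros;
  multiplied by \<open>h\<close> it exhibits \<open>h\<close> as a linear combination of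
  \<open>a\<close> and \<open>b\<close>.\<close>

definition bezout_on :: "complex set \<Rightarrow> (complex \<Rightarrow> complex) \<Rightarrow> (complex \<Rightarrow> complex) \<Rightarrow> bool" where
  "bezout_on S a b \<longleftrightarrow> (\<exists>h a' b' x y.
     h holomorphic_on S \<and> a' holomorphic_on S \<and> b' holomorphic_on S \<and>
     x holomorphic_on S \<and> y holomorphic_on S \<and>
     (\<forall>z\<in>S. a z = h z * a' z \<and> b z = h z * b' z \<and> x z * a' z + y z * b' z = 1))"

text \<open>If \<open>b\<close> vanishes at \<open>s\<close>, the factor \<open>z - s\<close> is
  common and moves into \<open>h\<close>; the hypothesis is then applied to
  \<open>b / (z - s)\<close>, which is why it ranges over all \<open>b\<close>. Otherwise
  \<open>h\<close> is kept, and \<open>b' s \<noteq> 0\<close> allows the coefficients to be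
  corrected.\<close>

lemma bezout_on_mult_linear:
  assumes IH: "\<And>b. b holomorphic_on S \<Longrightarrow> bezout_on S a b"
    and S: "open S" and s: "s \<in> S" and b: "b holomorphic_on S"
  shows "bezout_on S (\<lambda>z. (z - s) * a z) b"
proof (cases "b s = 0")
  case True
  \<comment> \<open>The quotient of \<open>b\<close> by \<open>z - s\<close>, with the removable
    singularity filled by the derivative.\<close>
  define q where "q z = (if z = s then deriv b s else (b z - b s) / (z - s))" for z
  have "q holomorphic_on S"
    unfolding q_def by (rule pole_lemma_open[OF b S])
  from IH[OF this] obtain h a' b' x y where
    hol: "h holomorphic_on S" "a' holomorphic_on S" "b' holomorphic_on S"
      "x holomorphic_on S" "y holomorphic_on S"
    and eq: "\<forall>z\<in>S. a z = h z * a' z \<and> q z = h z * b' z \<and> x z * a' z + y z * b' z = 1"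
    unfolding bezout_on_def by blast
  have "b z = (z - s) * q z" for z
    using True by (simp add: q_def)
  then have "\<forall>z\<in>S. (z - s) * a z = ((z - s) * h z) * a' z \<and> b z = ((z - s) * h z) * b' z \<and>
     x z * a' z + y z * b' z = 1"
    using eq by (simp add: mult.assoc)
  moreover have "(\<lambda>z. (z - s) * h z) holomorphic_on S"
    by (intro holomorphic_intros hol)
  ultimately show ?thesis
    unfolding bezout_on_def using hol by blast
next
  case False
  from IH[OF b] obtain h a' b' x y where
    hol: "h holomorphic_on S" "a' holomorphic_on S" "b' holomorphic_on S"
      "x holomorphic_on S" "y holomorphic_on S"
    and eq: "\<And>z. z \<in> S \<Longrightarrow> a z = h z * a' z" "\<And>z. z \<in> S \<Longrightarrow> b z = h z * b' z"
      "\<And>z. z \<in> S \<Longrightarrow> x z * a' z + y z * b' z = 1"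
    unfolding bezout_on_def by blast
  have b's: "b' s \<noteq> 0" using False eq(2)[OF s] by auto
  define q where "q z = (if z = s then deriv b' s else (b' z - b' s) / (z - s))" for z
  have q: "q holomorphic_on S"
    unfolding q_def by (rule pole_lemma_open[OF hol(3) S])
  have b': "b' z = b' s + (z - s) * q z" for z
    by (simp add: q_def)
  \<comment> \<open>multiply \<open>x a' + y b' = 1\<close> by \<open>(b' - (z - s) q) / b'(s) = 1\<close>\<close>
  define x' where "x' z = - x z * q z / b' s" for z
  define y' where "y' z = y z * (z - s) * (- q z / b' s) + 1 / b' s * (x z * a' z + y z * b' z)" for z
  have hols: "(\<lambda>z. (z - s) * a' z) holomorphic_on S" "x' holomorphic_on S" "y' holomorphic_on S"
    unfolding x'_def y'_def by (intro holomorphic_intros hol q b's)+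
  have "x' z * ((z - s) * a' z) + y' z * b' z = 1" if "z \<in> S" for z
  proof -
    have "x' z * ((z - s) * a' z) + y' z * b' z =
      (x z * a' z + y z * b' z) * (b' z - (z - s) * q z) / b' s"
      by (simp add: x'_def y'_def add_divide_distrib diff_divide_distrib algebra_simps)
    also have "\<dots> = 1"
      using b'[of z] eq(3)[OF that] b's by simp
    finally show ?thesis .
  qed
  moreover have "(z - s) * a z = h z * ((z - s) * a' z)" if "z \<in> S" for z
    using eq(1)[OF that] by simp
  ultimately have "\<forall>z\<in>S. (z - s) * a z = h z * ((z - s) * a' z) \<and> b z = h z * b' z \<and>
      x' z * ((z - s) * a' z) + y' z * b' z = 1"
    using eq(2) by simp
  with hols show ?thesis
    unfolding bezout_on_def using hol(1,3)
    by (intro exI[of _ h] exI[of _ "\<lambda>z. (z - s) * a' z"] exI[of _ b'] exI[of _ x'] exI[of _ y'] conjI)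
qed

lemma bezout_on_cong:
  assumes "\<And>z. z \<in> S \<Longrightarrow> a z = a' z"
  shows "bezout_on S a b = bezout_on S a' b"
  unfolding bezout_on_def using assms by simp

text \<open>Induction on the number of distinct zeros. At a zero \<open>s\<close> the full power of
  \<open>z - s\<close> is divided out, which removes exactly that zero, and its linear factors are
  then put back one by one with \<open>bezout_on_mult_linear\<close>. Without zeros,
  \<open>a\<close> is a unit.\<close>

lemma bezout_on_finite_zeros:
  assumes S: "open S" "connected S" and "a holomorphic_on S" "b holomorphic_on S"
    and w: "w \<in> S" "a w \<noteq> 0" and "finite {z\<in>S. a z = 0}"
  shows "bezout_on S a b"
  using assms(3,4,6,7)
proof (induction "card {z\<in>S. a z = 0}" arbitrary: a b)
  case 0
  then have nz: "a z \<noteq> 0" if "z \<in> S" for z using that by auto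
  have "\<forall>z\<in>S. a z = 1 * a z \<and> b z = 1 * b z \<and> inverse (a z) * a z + 0 * b z = 1"
    using nz by simp
  moreover have "(\<lambda>z. inverse (a z)) holomorphic_on S"
    using nz 0 by (intro holomorphic_intros) auto
  moreover have "(\<lambda>z. 1) holomorphic_on S" "(\<lambda>z. 0) holomorphic_on S"
    by auto
  ultimately show ?case
    unfolding bezout_on_def using 0 by blast
next
  case (Suc k)
  from Suc.hyps(2) obtain s where s: "s \<in> S" "a s = 0"
    by (metis (mono_tags, lifting) card.empty empty_Collect_eq nat.distinct(1))
  obtain n g where g: "g holomorphic_on S" "g s \<noteq> 0" "\<And>z. z \<in> S \<Longrightarrow> a z = (z - s) ^ n * g z"
    using holomorphic_factor_out_zero[OF Suc.prems(1) S s(1) w(1) Suc.prems(3)] by metis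
  have n: "n > 0" using g(2) g(3)[OF s(1)] s(2) by (cases n) auto
  have zs: "{z\<in>S. g z = 0} = {z\<in>S. a z = 0} - {s}"
    using g n by auto
  have "bezout_on S g b" if "b holomorphic_on S" for b
  proof (rule Suc.hyps(1))
    show "k = card {z\<in>S. g z = 0}"
      using Suc.hyps(2) Suc.prems(4) s unfolding zs by (subst card_Diff_singleton) auto
    show "g w \<noteq> 0" using g(3)[OF w(1)] Suc.prems(3) by auto
    show "finite {z\<in>S. g z = 0}" using Suc.prems(4) unfolding zs by simp
  qed fact+
  then have "bezout_on S (\<lambda>z. (z - s) ^ m * g z) b" if "b holomorphic_on S" for b m
    using that
  proof (induction m arbitrary: b)
    case (Suc m)
    have "bezout_on S (\<lambda>z. (z - s) * ((z - s) ^ m * g z)) b"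
      using Suc S s(1) by (intro bezout_on_mult_linear) auto
    then show ?case by (simp add: mult.assoc)
  qed auto
  from this[OF Suc.prems(2), of n] show ?case
    using bezout_on_cong[of S a "\<lambda>z. (z - s) ^ n * g z" b] g(3) by simp
qed

section \<open>Taylor approximation and the additive Cousin problem on exhausting discs\<close>

text \<open>The Taylor series at 0 has radius of convergence at least \<open>R\<close>, so its
  partial sums, which are polynomials, converge uniformly on the closed disc of radius
  \<open>s\<close>.\<close>

lemma entire_approximation_on_ball:
  fixes f :: "complex \<Rightarrow> complex"
  assumes f: "f holomorphic_on ball 0 R" and "s < R" "0 < e"
  obtains p where "p holomorphic_on UNIV" "\<And>z. z \<in> ball 0 s \<Longrightarrow> norm (f z - p z) < e"
proof -
  define c where "c n = (deriv ^^ n) f 0 / fact n" for n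
  have sums: "(\<lambda>n. c n * z ^ n) sums f z" if "z \<in> ball 0 R" for z
    using holomorphic_power_series[OF f that] by (simp add: c_def)
  have "ereal R \<le> conv_radius c"
  proof (rule conv_radius_geI_ex')
    fix t :: real assume "0 < t" "ereal t < ereal R"
    then show "summable (\<lambda>n. c n * complex_of_real t ^ n)"
      using sums[of "of_real t"] by (auto simp: sums_iff)
  qed
  then have "ereal s < conv_radius c"
    using \<open>s < R\<close> by (meson ereal_less_eq(3) less_ereal.simps(1) less_le_trans)
  from powser_uniform_limit[OF this, of 0]
  have "uniform_limit (cball 0 s) (\<lambda>n z. \<Sum>i<n. c i * z ^ i) (\<lambda>z. \<Sum>i. c i * z ^ i) sequentially"
    by simp
  from uniform_limitD[OF this \<open>0 < e\<close>] obtain n where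
    n: "\<forall>z\<in>cball 0 s. dist (\<Sum>i<n. c i * z ^ i) (\<Sum>i. c i * z ^ i) < e"
    by (auto simp: eventually_sequentially)
  show ?thesis
  proof
    show "(\<lambda>z. \<Sum>i<n. c i * z ^ i) holomorphic_on UNIV"
      by (intro holomorphic_intros)
    fix z assume z: "z \<in> ball (0::complex) s"
    then have "z \<in> ball 0 R" using \<open>s < R\<close> by auto
    then have "(\<Sum>i. c i * z ^ i) = f z" using sums by (simp add: sums_iff)
    then show "norm (f z - (\<Sum>i<n. c i * z ^ i)) < e"
      using n z by (metis ball_subset_cball dist_norm norm_minus_commute subsetD)
  qed
qed

text \<open>Treats the plane and the unit disc at once. Strict growth of the radii puts each closed
  disc inside the next open one, which gives room for Taylor approximation and compactness.\<close>

locale disc_exhaustion =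
  fixes r :: "nat \<Rightarrow> real" and M :: "complex set"
  assumes r0: "0 < r 0" and r_mono: "strict_mono r"
    and M: "M = (\<Union>n. ball 0 (r n))"
begin

abbreviation D :: "nat \<Rightarrow> complex set" where "D n \<equiv> ball 0 (r n)"

lemma r_pos: "0 < r n"
  using r0 strict_mono_less_eq[OF r_mono, of 0 n] by linarith

lemma D_mono: "m \<le> n \<Longrightarrow> D m \<subseteq> D n"
  using strict_mono_less_eq[OF r_mono] by (intro subset_ball) blast

lemma D_subset: "D n \<subseteq> M"
  using M by auto

lemma cball_subset: "cball 0 (r n) \<subseteq> M"
proof -
  have "r n < r (Suc n)" using r_mono by (simp add: strict_mono_Suc_iff)
  then have "cball 0 (r n) \<subseteq> D (Suc n)" by auto
  then show ?thesis using D_subset by blast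
qed

lemma open_M: "open M"
  using M by auto

lemma connected_M: "connected M"
  unfolding M
proof (rule connected_Union)
  have "0 \<in> \<Inter> (range D)" using r_pos by auto
  then show "\<Inter> (range D) \<noteq> {}" by blast
qed auto

text \<open>Agreement of neighbours propagates to all larger indices, so choosing the least
  admissible index in \<open>F\<close> is immaterial.\<close>

lemma glue:
  fixes f :: "nat \<Rightarrow> complex \<Rightarrow> complex"
  assumes f: "\<And>n. f n holomorphic_on D n"
    and eq: "\<And>n z. z \<in> D n \<Longrightarrow> f (Suc n) z = f n z"
  obtains F where "F holomorphic_on M" "\<And>n z. z \<in> D n \<Longrightarrow> F z = f n z"
proof -
  have eq': "f n z = f m z" if "m \<le> n" "z \<in> D m" for m n z
    using that
  proof (induction n rule: dec_induct)
    case (step n)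
    then have "z \<in> D n" using D_mono by blast
    then show ?case using step eq by simp
  qed simp
  define F where "F z = f (LEAST n. z \<in> D n) z" for z
  have F: "F z = f n z" if "z \<in> D n" for n z
    unfolding F_def using that
    by (intro eq'[symmetric]) (auto intro: Least_le LeastI simp del: mem_ball)
  have "F holomorphic_on D n" for n
    using f[of n] by (rule holomorphic_transform) (simp add: F)
  then have "F holomorphic_on M"
    unfolding M by (intro holomorphic_on_UN_open) auto
  then show ?thesis using F that by blast
qed

text \<open>Formally \<open>g n\<close> is minus the sum of all \<open>k j\<close> with
  \<open>j \<ge> n\<close>, which need not converge. Subtracting entire approximants
  \<open>p j\<close> makes the tails converge, and the finite sums of the \<open>p j\<close>
  compensate for this.\<close>

lemma additive_cousin:
  fixes k :: "nat \<Rightarrow> complex \<Rightarrow> complex"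
  assumes k: "\<And>n. k n holomorphic_on D n"
  obtains g where "\<And>n. g n holomorphic_on D n"
    "\<And>n z. z \<in> D n \<Longrightarrow> g (Suc n) z - g n z = k n z"
proof -
  \<comment> \<open>Approximation needs a smaller disc, hence \<open>D (n - 1)\<close>; for
    \<open>n = 0\<close> there is none, and nothing is demanded of \<open>p\<close>.\<close>
  have "\<exists>p. p holomorphic_on UNIV \<and> (\<forall>z\<in>D (n - 1). n > 0 \<longrightarrow> norm (k n z - p z) < (1/2) ^ n)" for n
  proof (cases n)
    case 0
    then show ?thesis by (auto intro: exI[of _ "\<lambda>_. 0"])
  next
    case (Suc m)
    then have "r m < r n" using r_mono by (simp add: strict_mono_Suc_iff)
    from entire_approximation_on_ball[OF k this, of "(1/2) ^ n"] show ?thesis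
      using Suc by (metis diff_Suc_1 zero_less_divide_1_iff zero_less_numeral zero_less_power)
  qed
  then obtain p where p: "\<And>n. p n holomorphic_on UNIV"
    and approx: "\<And>n z. z \<in> D (n - 1) \<Longrightarrow> n > 0 \<Longrightarrow> norm (k n z - p n z) < (1/2) ^ n"
    by metis
  have p': "p n holomorphic_on T" for n T
    using p holomorphic_on_subset by blast
  have k': "k n holomorphic_on D m" if "m \<le> n" for m n
    using k D_mono[OF that] holomorphic_on_subset by blast
  define e where "e n z = k n z - p n z" for n z
  define E where "E n z = (\<Sum>j. e (j + n) z)" for n z
  have e_bound: "norm (e (j + Suc n) z) \<le> (1/2) ^ j" if "z \<in> D n" for j n z
  proof -
    have "z \<in> D (j + Suc n - 1)" using that D_mono[of n "j + Suc n - 1"] by auto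
    then have "norm (e (j + Suc n) z) < (1/2) ^ (j + Suc n)"
      unfolding e_def by (intro approx) auto
    also have "\<dots> \<le> (1/2) ^ j" by (intro power_decreasing) auto
    finally show ?thesis by simp
  qed
  have geo: "summable (\<lambda>j. (1/2 :: real) ^ j)" by (intro summable_geometric) auto
  have ul: "uniform_limit (D n) (\<lambda>m z. \<Sum>j<m. e (j + Suc n) z) (E (Suc n)) sequentially" for n
    unfolding E_def by (rule Weierstrass_m_test[OF e_bound geo])
  have E_hol: "E (Suc n) holomorphic_on D n" for n
  proof (rule holomorphic_uniform_sequence[OF open_ball])
    show "(\<lambda>z. \<Sum>j<m. e (j + Suc n) z) holomorphic_on D n" for m
      unfolding e_def by (intro holomorphic_intros k' p') auto
    fix z assume "z \<in> D n"
    then obtain d where "0 < d" "cball z d \<subseteq> D n"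
      using open_contains_cball[of "D n"] open_ball by blast
    then show "\<exists>d>0. cball z d \<subseteq> D n \<and>
        uniform_limit (cball z d) (\<lambda>m z. \<Sum>j<m. e (j + Suc n) z) (E (Suc n)) sequentially"
      using uniform_limit_on_subset[OF ul] by blast
  qed
  have E_eq: "E n z = e n z + E (Suc n) z" if "z \<in> D n" for n z
  proof -
    have "summable (\<lambda>j. e (j + Suc n) z)"
      using e_bound[OF that] by (intro summable_comparison_test'[OF geo]) auto
    then have "summable (\<lambda>j. e (j + n) z)"
      using summable_iff_shift[of "\<lambda>j. e (j + n) z" 1] by simp
    from suminf_split_initial_segment[OF this, of 1] show ?thesis
      by (simp add: E_def)
  qed
  \<comment> \<open>This is the sum of the \<open>p j\<close> minus \<open>E n\<close>, with the
    first term of \<open>E n\<close> split off: on \<open>D n\<close> the geometric bound holds only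
    from index \<open>n + 1\<close> on.\<close>
  define g where "g n z = (\<Sum>j<n. p j z) - (e n z + E (Suc n) z)" for n z
  show ?thesis
  proof
    show "g n holomorphic_on D n" for n
      unfolding g_def e_def by (intro holomorphic_intros E_hol p' k) 
    fix n z assume z: "z \<in> D n"
    then have z': "z \<in> D (Suc n)" using D_mono[of n "Suc n"] by auto
    show "g (Suc n) z - g n z = k n z"
      unfolding g_def using E_eq[OF z'] by (simp add: e_def)
  qed
qed

section \<open>Gluing the Bezout identities of the discs\<close>

text \<open>The Cousin problem is solved twice: first for logarithms of the units relating the
  divisors \<open>h n\<close>, which yields global \<open>H\<close>, \<open>A\<close>,
  \<open>B\<close>; then for the multiples of \<open>(B, -A)\<close> by which the Bezout
  coefficients differ.\<close>

lemma bezout_on_M: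
  assumes a: "a holomorphic_on M" and b: "b holomorphic_on M" and w: "w \<in> M" "a w \<noteq> 0"
  shows "bezout_on M a b"
proof -
  note holD = holomorphic_on_subset[OF _ D_subset]
  have nz: "\<exists>z\<in>D n. a z \<noteq> 0" for n
  proof (rule ccontr)
    assume "\<not> ?thesis"
    moreover have "0 islimpt D n"
      using r_pos[of n] by (intro interior_limit_point) (simp add: interior_open)
    moreover have "0 \<in> M" using r_pos[of 0] D_subset[of 0] by force
    ultimately show False
      using analytic_continuation[OF a open_M connected_M D_subset, of 0 n w] w by blast
  qed
  \<comment> \<open>Finiteness is proved on the closed disc, which is compact and still lies in
    \<open>M\<close>.\<close>
  have fin_cball: "finite {z\<in>cball 0 (r n). a z = 0}" for n
  proof (cases "a constant_on M")
    case True
    then have "a z \<noteq> 0" if "z \<in> M" for z using w that by (metis constant_on_def)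
    then have "{z\<in>cball 0 (r n). a z = 0} = {}" using cball_subset by blast
    then show ?thesis by (simp only: finite.emptyI)
  next
    case False
    then show ?thesis
      using holomorphic_compact_finite_zeros[OF a open_M connected_M compact_cball cball_subset]
      by blast
  qed
  have fin: "finite {z\<in>D n. a z = 0}" for n
  proof (rule finite_subset)
    show "{z\<in>D n. a z = 0} \<subseteq> {z\<in>cball 0 (r n). a z = 0}"
      using ball_subset_cball by blast
  qed (rule fin_cball)
  have "bezout_on (D n) a b" for n
    using nz[of n] bezout_on_finite_zeros[OF open_ball connected_ball holD[OF a] holD[OF b] _ _ fin]
    by blast
  then obtain h a1 b1 x y where
    hol: "\<And>n. h n holomorphic_on D n" "\<And>n. a1 n holomorphic_on D n" "\<And>n. b1 n holomorphic_on D n"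
      "\<And>n. x n holomorphic_on D n" "\<And>n. y n holomorphic_on D n"
    and eq: "\<And>n z. z \<in> D n \<Longrightarrow> a z = h n z * a1 n z" "\<And>n z. z \<in> D n \<Longrightarrow> b z = h n z * b1 n z"
      "\<And>n z. z \<in> D n \<Longrightarrow> x n z * a1 n z + y n z * b1 n z = 1"
    unfolding bezout_on_def by metis
  have D_Suc: "z \<in> D (Suc n)" if "z \<in> D n" for n z
    using that D_mono[of n "Suc n"] by auto
  have hol_Suc: "f holomorphic_on D n" if "f holomorphic_on D (Suc n)" for n f
    using that D_mono[of n "Suc n"] holomorphic_on_subset by auto
  note hols = hol hol[THEN hol_Suc]
  have cancel: "f z = g z"
    if "f holomorphic_on D n" "g holomorphic_on D n" "z \<in> D n"
      "\<And>z. z \<in> D n \<Longrightarrow> h n z * f z = h n z * g z" for f g n z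
  proof -
    obtain u where "u \<in> D n" "a u \<noteq> 0" using nz by blast
    moreover from this have "h n u \<noteq> 0" using eq(1) by auto
    ultimately show ?thesis
      using holomorphic_cancel_left[OF open_ball connected_ball that(1,2) hol(1) _ _ that(4,3)] by blast
  qed
  \<comment> \<open>\<open>s n\<close> and \<open>t n\<close> are the quotients of
    \<open>h (Suc n)\<close> and \<open>h n\<close> in the two orders, expressed without division by
    pairing the coefficients from one disc with the cofactors from the other.\<close>
  define s where "s n z = x (Suc n) z * a1 n z + y (Suc n) z * b1 n z" for n z
  define t where "t n z = x n z * a1 (Suc n) z + y n z * b1 (Suc n) z" for n z
  have s_hol: "s n holomorphic_on D n" and t_hol: "t n holomorphic_on D n" for n
    unfolding s_def t_def by (intro holomorphic_intros hols)+
  have hs: "h (Suc n) z = h n z * s n z" and ht: "h n z = h (Suc n) z * t n z"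
    if z: "z \<in> D n" for n z
  proof -
    have ab: "h (Suc n) z * a1 (Suc n) z = h n z * a1 n z" "h (Suc n) z * b1 (Suc n) z = h n z * b1 n z"
      using eq(1,2)[OF z] eq(1,2)[OF D_Suc[OF z]] by simp_all
    have "h (Suc n) z = x (Suc n) z * (h (Suc n) z * a1 (Suc n) z) + y (Suc n) z * (h (Suc n) z * b1 (Suc n) z)"
      using arg_cong[OF eq(3)[OF D_Suc[OF z]], of "\<lambda>u. h (Suc n) z * u"] by (simp add: algebra_simps)
    then show "h (Suc n) z = h n z * s n z"
      unfolding ab by (simp add: s_def algebra_simps)
    have "h n z = x n z * (h n z * a1 n z) + y n z * (h n z * b1 n z)"
      using arg_cong[OF eq(3)[OF z], of "\<lambda>u. h n z * u"] by (simp add: algebra_simps)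
    then show "h n z = h (Suc n) z * t n z"
      unfolding ab[symmetric] by (simp add: t_def algebra_simps)
  qed
  \<comment> \<open>Cancelling \<open>h n\<close> gives this also at the zeros of
    \<open>h n\<close>, so \<open>s n\<close> is a unit on all of \<open>D n\<close>.\<close>
  have "s n z * t n z = 1" if "z \<in> D n" for n z
  proof (rule cancel[OF _ _ that])
    show "h n z * (s n z * t n z) = h n z * 1" if "z \<in> D n" for z
      using hs[OF that] ht[OF that] by (metis mult.assoc mult.right_neutral)
  qed (intro holomorphic_intros s_hol t_hol)+
  then have s_nz: "s n z \<noteq> 0" if "z \<in> D n" for n z using that by force
  have "\<exists>k. k holomorphic_on D n \<and> (\<forall>z\<in>D n. exp (k z) = s n z)" for n
    by (rule holomorphic_logarithm_exists[OF convex_ball open_ball s_hol s_nz, of n 0])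
      (use r_pos in auto)
  then obtain k where k: "\<And>n. k n holomorphic_on D n" "\<And>n z. z \<in> D n \<Longrightarrow> exp (k n z) = s n z"
    by metis
  \<comment> \<open>By this choice \<open>exp (g n)\<close> picks up the factor \<open>s n\<close>
    from one disc to the next, so that \<open>h n z * exp (- g n z)\<close> no longer depends on
    \<open>n\<close>.\<close>
  obtain g where g: "\<And>n. g n holomorphic_on D n"
    "\<And>n z. z \<in> D n \<Longrightarrow> g (Suc n) z - g n z = k n z"
    using additive_cousin[OF k(1)] by blast
  have g_Suc: "exp (g (Suc n) z) = exp (g n z) * s n z" if "z \<in> D n" for n z
    using g(2)[OF that] k(2)[OF that] by (metis add_diff_cancel_left' exp_add diff_add_cancel add.commute)
  have a1: "a1 n z = s n z * a1 (Suc n) z" if "z \<in> D n" for n z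
  proof (rule cancel[OF _ _ that])
    show "h n z * a1 n z = h n z * (s n z * a1 (Suc n) z)" if "z \<in> D n" for z
      using eq(1)[OF that] eq(1)[OF D_Suc[OF that]] hs[OF that] by (metis mult.assoc)
  qed (intro holomorphic_intros hols s_hol)+
  have b1: "b1 n z = s n z * b1 (Suc n) z" if "z \<in> D n" for n z
  proof (rule cancel[OF _ _ that])
    show "h n z * b1 n z = h n z * (s n z * b1 (Suc n) z)" if "z \<in> D n" for z
      using eq(2)[OF that] eq(2)[OF D_Suc[OF that]] hs[OF that] by (metis mult.assoc)
  qed (intro holomorphic_intros hols s_hol)+
  obtain H where H: "H holomorphic_on M" "\<And>n z. z \<in> D n \<Longrightarrow> H z = h n z * exp (- g n z)"
  proof (rule glue[of "\<lambda>n z. h n z * exp (- g n z)"])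
    show "(\<lambda>z. h n z * exp (- g n z)) holomorphic_on D n" for n
      by (intro holomorphic_intros hols g)
    show "h (Suc n) z * exp (- g (Suc n) z) = h n z * exp (- g n z)" if "z \<in> D n" for n z
      using hs[OF that] g_Suc[OF that] s_nz[OF that] by (simp add: exp_minus)
  qed blast
  obtain A where A: "A holomorphic_on M" "\<And>n z. z \<in> D n \<Longrightarrow> A z = a1 n z * exp (g n z)"
  proof (rule glue[of "\<lambda>n z. a1 n z * exp (g n z)"])
    show "(\<lambda>z. a1 n z * exp (g n z)) holomorphic_on D n" for n
      by (intro holomorphic_intros hols g)
    show "a1 (Suc n) z * exp (g (Suc n) z) = a1 n z * exp (g n z)" if "z \<in> D n" for n z
      using a1[OF that] g_Suc[OF that] by simp
  qed blast
  obtain B where B: "B holomorphic_on M" "\<And>n z. z \<in> D n \<Longrightarrow> B z = b1 n z * exp (g n z)"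
  proof (rule glue[of "\<lambda>n z. b1 n z * exp (g n z)"])
    show "(\<lambda>z. b1 n z * exp (g n z)) holomorphic_on D n" for n
      by (intro holomorphic_intros hols g)
    show "b1 (Suc n) z * exp (g (Suc n) z) = b1 n z * exp (g n z)" if "z \<in> D n" for n z
      using b1[OF that] g_Suc[OF that] by simp
  qed blast
  define X where "X n z = x n z * exp (- g n z)" for n z
  define Y where "Y n z = y n z * exp (- g n z)" for n z
  have XY_hol: "X n holomorphic_on D n" "Y n holomorphic_on D n" for n
    unfolding X_def Y_def by (intro holomorphic_intros hols g)+
  have XY: "X n z * A z + Y n z * B z = 1" if "z \<in> D n" for n z
  proof -
    have "exp (- g n z) * exp (g n z) = 1" by (simp add: exp_minus)
    then show ?thesis
      using eq(3)[OF that] unfolding X_def Y_def A(2)[OF that] B(2)[OF that] by algebra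
  qed
  \<comment> \<open>\<open>(X (n+1) - X n, Y (n+1) - Y n)\<close> annihilates \<open>(A, B)\<close>, hence is a multiple of \<open>(B, -A)\<close>\<close>
  define T where "T n z = X (Suc n) z * Y n z - Y (Suc n) z * X n z" for n z
  have T: "X (Suc n) z - X n z = T n z * B z" "Y (Suc n) z - Y n z = - T n z * A z"
    if "z \<in> D n" for n z
    using XY[OF that] XY[OF D_Suc[OF that]] unfolding T_def by algebra+
  have "T n holomorphic_on D n" for n
    unfolding T_def by (intro holomorphic_intros XY_hol hol_Suc)
  from additive_cousin[OF this] obtain c where c: "\<And>n. c n holomorphic_on D n"
    "\<And>n z. z \<in> D n \<Longrightarrow> c (Suc n) z - c n z = T n z"
    by blast
  \<comment> \<open>Subtracting \<open>c n\<close> times \<open>(B, -A)\<close> from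
    \<open>(X n, Y n)\<close> removes the discrepancy and leaves the value of
    \<open>X n z * A z + Y n z * B z\<close> unchanged.\<close>
  obtain x' where x': "x' holomorphic_on M" "\<And>n z. z \<in> D n \<Longrightarrow> x' z = X n z - c n z * B z"
  proof (rule glue[of "\<lambda>n z. X n z - c n z * B z"])
    show "(\<lambda>z. X n z - c n z * B z) holomorphic_on D n" for n
      by (intro holomorphic_intros XY_hol c holD[OF B(1)])
    show "X (Suc n) z - c (Suc n) z * B z = X n z - c n z * B z" if "z \<in> D n" for n z
      using T(1)[OF that] c(2)[OF that] by algebra
  qed blast
  obtain y' where y': "y' holomorphic_on M" "\<And>n z. z \<in> D n \<Longrightarrow> y' z = Y n z + c n z * A z"
  proof (rule glue[of "\<lambda>n z. Y n z + c n z * A z"])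
    show "(\<lambda>z. Y n z + c n z * A z) holomorphic_on D n" for n
      by (intro holomorphic_intros XY_hol c holD[OF A(1)])
    show "Y (Suc n) z + c (Suc n) z * A z = Y n z + c n z * A z" if "z \<in> D n" for n z
      using T(2)[OF that] c(2)[OF that] by algebra
  qed blast
  have "a z = H z * A z \<and> b z = H z * B z \<and> x' z * A z + y' z * B z = 1" if "z \<in> M" for z
  proof -
    obtain n where z: "z \<in> D n" using \<open>z \<in> M\<close> M by blast
    have "x' z * A z + y' z * B z = X n z * A z + Y n z * B z"
      unfolding x'(2)[OF z] y'(2)[OF z] by (simp add: algebra_simps)
    moreover have "exp (- g n z) * exp (g n z) = 1" by (simp add: exp_minus)
    then have "H z * A z = a z" "H z * B z = b z"
      unfolding eq(1,2)[OF z] H(2)[OF z] A(2)[OF z] B(2)[OF z] by algebra+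
    ultimately show ?thesis
      using XY[OF z] by simp
  qed
  then show ?thesis
    unfolding bezout_on_def using H(1) A(1) B(1) x'(1) y'(1)
    by (intro exI[of _ H] exI[of _ A] exI[of _ B] exI[of _ x'] exI[of _ y'] conjI ballI) auto
qed

end

section \<open>Complex quaternions as matrices\<close>

text \<open>
  The isomorphism with 2x2 matrices sends \<open>e\<^sub>1\<close>, \<open>e\<^sub>2\<close>, \<open>e\<^sub>3\<close> to \<open>(i, 0; 0, -i)\<close>, \<open>(0, 1; -1, 0)\<close>,
  \<open>(0, i; i, 0)\<close>.
\<close>
definition cq_mat :: "complex \<Rightarrow> complex \<Rightarrow> complex \<Rightarrow> complex \<Rightarrow> cquat" where
  "cq_mat a b c d = CQuat ((a + d) / 2) ((a - d) / (2 * \<i>)) ((b - c) / 2) ((b + c) / (2 * \<i>))"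

definition m11 :: "cquat \<Rightarrow> complex" where "m11 q = cq0 q + \<i> * cq1 q"
definition m12 :: "cquat \<Rightarrow> complex" where "m12 q = cq2 q + \<i> * cq3 q"
definition m21 :: "cquat \<Rightarrow> complex" where "m21 q = - cq2 q + \<i> * cq3 q"
definition m22 :: "cquat \<Rightarrow> complex" where "m22 q = cq0 q - \<i> * cq1 q"

lemmas m_defs = m11_def m12_def m21_def m22_def

lemma m_cq_mat [simp]:
  "m11 (cq_mat a b c d) = a" "m12 (cq_mat a b c d) = b"
  "m21 (cq_mat a b c d) = c" "m22 (cq_mat a b c d) = d"
  by (simp_all add: m_defs cq_mat_def field_simps)

lemma cquat_eq_iff_mat:
  "p = q \<longleftrightarrow> m11 p = m11 q \<and> m12 p = m12 q \<and> m21 p = m21 q \<and> m22 p = m22 q"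
proof
  assume *: "m11 p = m11 q \<and> m12 p = m12 q \<and> m21 p = m21 q \<and> m22 p = m22 q"
  have "2 * cq0 p = 2 * cq0 q" "2 * cq2 p = 2 * cq2 q"
    "2 * \<i> * cq1 p = 2 * \<i> * cq1 q" "2 * \<i> * cq3 p = 2 * \<i> * cq3 q"
    using * unfolding m_defs by algebra+
  then show "p = q" by (simp add: cquat_eq_iff)
qed auto

lemma m_mult:
  "m11 (p * q) = m11 p * m11 q + m12 p * m21 q"
  "m12 (p * q) = m11 p * m12 q + m12 p * m22 q"
  "m21 (p * q) = m21 p * m11 q + m22 p * m21 q"
  "m22 (p * q) = m21 p * m12 q + m22 p * m22 q"
  by (simp_all add: m_defs times_cquat_def algebra_simps)

lemma m_zero [simp]: "m11 0 = 0" "m12 0 = 0" "m21 0 = 0" "m22 0 = 0"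
  by (simp_all add: m_defs zero_cquat_def)

lemma m_one [simp]: "m11 1 = 1" "m12 1 = 0" "m21 1 = 0" "m22 1 = 1"
  by (simp_all add: m_defs one_cquat_def)

lemma m_e2 [simp]: "m11 cq_e2 = 0" "m12 cq_e2 = 1" "m21 cq_e2 = -1" "m22 cq_e2 = 0"
  by (simp_all add: m_defs cq_e2_def)

lemma cq_symnorm_mat: "cq_symnorm q = cq_of_complex (m11 q * m22 q - m12 q * m21 q)"
  by (simp add: cq_symnorm_eq m_defs algebra_simps power2_eq_square)

lemma cq_of_complex_inject: "cq_of_complex a = cq_of_complex b \<longleftrightarrow> a = b"
  by (simp add: cq_of_complex_def)

lemma cq_symnorm_eq_0_iff: "cq_symnorm q = 0 \<longleftrightarrow> m11 q * m22 q = m12 q * m21 q"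
  unfolding cq_symnorm_mat cq_of_complex_ring_hom(1)[symmetric] cq_of_complex_inject by simp

lemma Sp1C_iff: "q \<in> Sp1C \<longleftrightarrow> m11 q * m22 q - m12 q * m21 q = 1"
  unfolding Sp1C_def mem_Collect_eq cq_symnorm_mat cq_of_complex_ring_hom(2)[symmetric]
    cq_of_complex_inject ..

lemma cq_symnorm_mult: "cq_symnorm (p * q) = cq_symnorm p * cq_symnorm q"
  unfolding cq_symnorm_mat m_mult cq_of_complex_ring_hom(4)[symmetric] cq_of_complex_inject
  by (simp add: algebra_simps)

lemma Sp1C_mult: "p \<in> Sp1C \<Longrightarrow> q \<in> Sp1C \<Longrightarrow> p * q \<in> Sp1C"
  by (simp add: Sp1C_def cq_symnorm_mult)

lemma one_in_Sp1C: "1 \<in> Sp1C"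
  by (simp add: Sp1C_def cq_symnorm_eq one_cquat_def cq_of_complex_def)

lemma e2_in_Sp1C: "cq_e2 \<in> Sp1C"
  by (simp add: Sp1C_iff)

lemma Sp1C_conj:
  assumes "q \<in> Sp1C"
  shows "cq_conj q \<in> Sp1C" "cq_conj q * q = 1" "q * cq_conj q = 1"
proof -
  show "q * cq_conj q = 1"
    using assms by (simp add: Sp1C_def cq_symnorm_def)
  moreover have "cq_conj q * q = q * cq_conj q"
    by (simp add: cq_conj_def times_cquat_def algebra_simps)
  moreover have "cq_conj (cq_conj q) = q" by (simp add: cq_conj_def)
  ultimately show "cq_conj q * q = 1" "cq_conj q \<in> Sp1C"
    by (simp_all add: Sp1C_def cq_symnorm_def)
qed

lemma cq_holomorphic_const: "(\<lambda>_. q) cq_holomorphic_on S"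
  by (simp add: cq_holomorphic_on_def)

lemma cq_holomorphic_mult:
  assumes "f cq_holomorphic_on S" "g cq_holomorphic_on S"
  shows "(\<lambda>z. f z * g z) cq_holomorphic_on S"
  using assms unfolding cq_holomorphic_on_def times_cquat_def cquat.sel
  by (auto intro!: holomorphic_intros)

lemma cq_holomorphic_compose:
  assumes "f cq_holomorphic_on T" "g holomorphic_on S" "g ` S \<subseteq> T"
  shows "(\<lambda>z. f (g z)) cq_holomorphic_on S"
  using assms holomorphic_on_compose_gen[of g S _ T]
  unfolding cq_holomorphic_on_def by (auto simp: o_def)

lemma cq_holomorphic_mat:
  assumes "a holomorphic_on S" "b holomorphic_on S" "c holomorphic_on S" "d holomorphic_on S"
  shows "(\<lambda>z. cq_mat (a z) (b z) (c z) (d z)) cq_holomorphic_on S"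
  unfolding cq_holomorphic_on_def cq_mat_def cquat.sel
  by (intro conjI holomorphic_intros assms) auto

lemma holomorphic_m:
  assumes "f cq_holomorphic_on S"
  shows "(\<lambda>z. m11 (f z)) holomorphic_on S" "(\<lambda>z. m12 (f z)) holomorphic_on S"
    "(\<lambda>z. m21 (f z)) holomorphic_on S" "(\<lambda>z. m22 (f z)) holomorphic_on S"
  using assms unfolding cq_holomorphic_on_def m_defs by (auto intro!: holomorphic_intros)

section \<open>Factorization of null maps over an exhaustion by discs\<close>

text \<open>This matrix unit is the reference null element: \<open>A z * E11 * B z\<close> is the
  first column of \<open>A z\<close> times the first row of \<open>B z\<close>.\<close>

definition E11 :: cquat where "E11 = cq_mat 1 0 0 0"

definition null_factorizable_on :: "complex set \<Rightarrow> (complex \<Rightarrow> cquat) \<Rightarrow> bool" where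
  "null_factorizable_on M \<Phi> \<longleftrightarrow> (\<exists>A B. A cq_holomorphic_on M \<and> B cq_holomorphic_on M \<and>
     (\<forall>z\<in>M. A z \<in> Sp1C \<and> B z \<in> Sp1C \<and> \<Phi> z = A z * E11 * B z))"

context disc_exhaustion
begin

text \<open>The Bezout identity for the first column gives \<open>(a, c) = h (a', c')\<close> with
  no common zero of \<open>a'\<close> and \<open>c'\<close>; the vanishing determinant makes the
  second column \<open>v (a', c')\<close>. Thus the matrix is the column \<open>(a', c')\<close>
  times the row \<open>(h, v)\<close>, and Bezout coefficients complete both to determinant
  one.\<close>

lemma null_factorizable_m11:
  assumes \<Phi>: "\<Phi> cq_holomorphic_on M"
    and null: "\<And>z. z \<in> M \<Longrightarrow> cq_symnorm (\<Phi> z) = 0"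
    and nz: "\<And>z. z \<in> M \<Longrightarrow> \<Phi> z \<noteq> 0"
    and w: "w \<in> M" "m11 (\<Phi> w) \<noteq> 0"
  shows "null_factorizable_on M \<Phi>"
proof -
  define a where "a z = m11 (\<Phi> z)" for z
  define b where "b z = m12 (\<Phi> z)" for z
  define c where "c z = m21 (\<Phi> z)" for z
  define d where "d z = m22 (\<Phi> z)" for z
  have hol: "a holomorphic_on M" "b holomorphic_on M" "c holomorphic_on M" "d holomorphic_on M"
    unfolding a_def b_def c_def d_def by (intro holomorphic_m[OF \<Phi>])+
  have det: "a z * d z = b z * c z" if "z \<in> M" for z
    using null[OF that] by (simp add: cq_symnorm_eq_0_iff a_def b_def c_def d_def)
  have aw: "a w \<noteq> 0" using w by (simp add: a_def)
  obtain h a' c' x y where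
    hol1: "h holomorphic_on M" "a' holomorphic_on M" "c' holomorphic_on M"
      "x holomorphic_on M" "y holomorphic_on M"
    and eq1: "\<And>z. z \<in> M \<Longrightarrow> a z = h z * a' z" "\<And>z. z \<in> M \<Longrightarrow> c z = h z * c' z"
      "\<And>z. z \<in> M \<Longrightarrow> x z * a' z + y z * c' z = 1"
    using bezout_on_M[OF hol(1,3) w(1) aw] unfolding bezout_on_def by blast
  have hw: "h w \<noteq> 0" using aw eq1(1)[OF w(1)] by auto
  have ad: "a' z * d z = c' z * b z" if "z \<in> M" for z
  proof (rule holomorphic_cancel_left[OF open_M connected_M _ _ hol1(1) w(1) hw _ that])
    show "h z * (a' z * d z) = h z * (c' z * b z)" if "z \<in> M" for z
      using eq1(1,2)[OF that] det[OF that] by (simp add: algebra_simps)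
  qed (intro holomorphic_intros hol hol1)+
  \<comment> \<open>The row \<open>(x, y)\<close> is a left inverse of the column
    \<open>(a', c')\<close>, so applied to the second column it returns the multiplier.\<close>
  define v where "v z = x z * b z + y z * d z" for z
  have v: "v holomorphic_on M"
    unfolding v_def by (intro holomorphic_intros hol hol1)
  have bd: "b z = a' z * v z" "d z = c' z * v z" if "z \<in> M" for z
    unfolding v_def using ad[OF that] eq1(3)[OF that] by algebra+
  obtain k h' v' x' y' where
    hol2: "k holomorphic_on M" "x' holomorphic_on M" "y' holomorphic_on M"
    and eq2: "\<And>z. z \<in> M \<Longrightarrow> h z = k z * h' z" "\<And>z. z \<in> M \<Longrightarrow> v z = k z * v' z"
      "\<And>z. z \<in> M \<Longrightarrow> x' z * h' z + y' z * v' z = 1"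
    using bezout_on_M[OF hol1(1) v w(1) hw] unfolding bezout_on_def by blast
  \<comment> \<open>A zero of the common divisor of \<open>h\<close> and \<open>v\<close> would be a
    zero of \<open>\<Phi>\<close>. Hence \<open>k\<close> is a unit, and dividing by it gives Bezout
    coefficients for \<open>h\<close> and \<open>v\<close> themselves.\<close>
  have k: "k z \<noteq> 0" if "z \<in> M" for z
  proof
    assume "k z = 0"
    then have "a z = 0" "b z = 0" "c z = 0" "d z = 0"
      using eq1[OF that] bd[OF that] eq2[OF that] by auto
    then show False
      using nz[OF that] by (simp add: cquat_eq_iff_mat a_def b_def c_def d_def)
  qed
  define A where "A z = cq_mat (a' z) (- y z) (c' z) (x z)" for z
  define B where "B z = cq_mat (h z) (v z) (- y' z / k z) (x' z / k z)" for z
  have "A cq_holomorphic_on M"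
    unfolding A_def by (intro cq_holomorphic_mat holomorphic_intros hol1)
  moreover have "B cq_holomorphic_on M"
    unfolding B_def by (intro cq_holomorphic_mat holomorphic_intros hol1 hol2 v k)
  moreover have "A z \<in> Sp1C" if "z \<in> M" for z
    using eq1(3)[OF that] by (simp add: Sp1C_iff A_def algebra_simps)
  moreover have "B z \<in> Sp1C" if "z \<in> M" for z
    using eq2[OF that] k[OF that] by (simp add: Sp1C_iff B_def algebra_simps)
  moreover have "\<Phi> z = A z * E11 * B z" if "z \<in> M" for z
    using eq1(1,2)[OF that] bd[OF that] unfolding cquat_eq_iff_mat m_mult A_def B_def E11_def
    by (simp add: a_def b_def c_def d_def mult.commute)
  ultimately show ?thesis
    unfolding null_factorizable_on_def by blast
qed

text \<open>A non-zero entry at 0 is moved to the upper left corner by constant factors from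
  \<open>Sp1C\<close>, which their conjugates undo afterwards.\<close>

lemma null_factorizable:
  assumes \<Phi>: "\<Phi> cq_holomorphic_on M"
    and null: "\<And>z. z \<in> M \<Longrightarrow> cq_symnorm (\<Phi> z) = 0"
    and nz: "\<And>z. z \<in> M \<Longrightarrow> \<Phi> z \<noteq> 0"
  shows "null_factorizable_on M \<Phi>"
proof -
  have w: "0 \<in> M" using r_pos[of 0] D_subset[of 0] by force
  \<comment> \<open>left and right multiplication by \<open>e\<^sub>2\<close> swap the rows and columns up to sign\<close>
  have "\<exists>P\<in>{1, cq_e2}. \<exists>Q\<in>{1, cq_e2}. m11 (P * \<Phi> 0 * Q) \<noteq> 0"
    using nz[OF w] cquat_eq_iff_mat[of "\<Phi> 0" 0] by (auto simp: m_mult)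
  then obtain P Q where PQ: "P \<in> Sp1C" "Q \<in> Sp1C" "m11 (P * \<Phi> 0 * Q) \<noteq> 0"
    using one_in_Sp1C e2_in_Sp1C by blast
  note P = Sp1C_conj[OF PQ(1)] and Q = Sp1C_conj[OF PQ(2)]
  have inv: "cq_conj P * (P * q * Q) * cq_conj Q = q" for q
  proof -
    have "cq_conj P * (P * q * Q) * cq_conj Q = (cq_conj P * P) * q * (Q * cq_conj Q)"
      by (simp only: mult.assoc)
    then show ?thesis using P Q by simp
  qed
  have "null_factorizable_on M (\<lambda>z. P * \<Phi> z * Q)"
  proof (rule null_factorizable_m11[where \<Phi> = "\<lambda>z. P * \<Phi> z * Q", OF _ _ _ w PQ(3)])
    show "(\<lambda>z. P * \<Phi> z * Q) cq_holomorphic_on M"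
      by (intro cq_holomorphic_mult cq_holomorphic_const \<Phi>)
    show "cq_symnorm (P * \<Phi> z * Q) = 0" if "z \<in> M" for z
      using null[OF that] by (simp add: cq_symnorm_mult)
    show "P * \<Phi> z * Q \<noteq> 0" if "z \<in> M" for z
      using inv[of "\<Phi> z"] nz[OF that] by auto
  qed
  then obtain A B where AB: "A cq_holomorphic_on M" "B cq_holomorphic_on M"
    "\<And>z. z \<in> M \<Longrightarrow> A z \<in> Sp1C" "\<And>z. z \<in> M \<Longrightarrow> B z \<in> Sp1C"
    "\<And>z. z \<in> M \<Longrightarrow> P * \<Phi> z * Q = A z * E11 * B z"
    unfolding null_factorizable_on_def by blast
  have "\<Phi> z = (cq_conj P * A z) * E11 * (B z * cq_conj Q)" if "z \<in> M" for z
    using inv[of "\<Phi> z"] unfolding AB(5)[OF that] by (simp only: mult.assoc)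
  moreover have "(\<lambda>z. cq_conj P * A z) cq_holomorphic_on M" "(\<lambda>z. B z * cq_conj Q) cq_holomorphic_on M"
    by (intro cq_holomorphic_mult cq_holomorphic_const AB)+
  moreover have "cq_conj P * A z \<in> Sp1C" "B z * cq_conj Q \<in> Sp1C" if "z \<in> M" for z
    by (intro Sp1C_mult P Q AB that)+
  ultimately show ?thesis
    unfolding null_factorizable_on_def
    by (intro exI[of _ "\<lambda>z. cq_conj P * A z"] exI[of _ "\<lambda>z. B z * cq_conj Q"]) blast
qed

end

section \<open>Transfer to simply connected domains and to an arbitrary \<open>L0\<close>\<close>

lemma disc_exhaustion_UNIV: "disc_exhaustion (\<lambda>n. real n + 1) UNIV"
proof
  show "(UNIV :: complex set) = (\<Union>n. ball 0 (real n + 1))"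
  proof (intro equalityI subsetI)
    fix z :: complex
    obtain n where "norm z < real n" using reals_Archimedean2 by blast
    then show "z \<in> (\<Union>n. ball 0 (real n + 1))" by (auto intro!: exI[of _ n])
  qed simp
qed (auto simp: strict_mono_def)

text \<open>The offset 2 makes the first radius \<open>1 / 2\<close>, since the locale requires it
  to be positive.\<close>

lemma disc_exhaustion_unit_disc: "disc_exhaustion (\<lambda>n. 1 - 1 / (real n + 2)) (ball 0 1)"
proof
  show "(ball 0 1 :: complex set) = (\<Union>n. ball 0 (1 - 1 / (real n + 2)))"
  proof (intro equalityI subsetI)
    fix z :: complex assume "z \<in> ball 0 1"
    then have "0 < 1 - norm z" by simp
    then obtain n where n: "inverse (real (Suc n)) < 1 - norm z"
      using reals_Archimedean by blast
    have "1 / (real n + 2) \<le> inverse (real (Suc n))"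
      by (simp add: field_simps)
    then have "norm z < 1 - 1 / (real n + 2)" using n by linarith
    then show "z \<in> (\<Union>n. ball 0 (1 - 1 / (real n + 2)))" by auto
  next
    fix z :: complex assume "z \<in> (\<Union>n. ball 0 (1 - 1 / (real n + 2)))"
    then obtain n where "norm z < 1 - 1 / (real n + 2)" by auto
    also have "\<dots> < 1" by simp
    finally show "z \<in> ball 0 1" by simp
  qed
next
  show "strict_mono (\<lambda>n. 1 - 1 / (real n + 2))"
    unfolding strict_mono_Suc_iff by (simp add: field_simps)
qed simp

text \<open>A Riemann map \<open>f\<close> with inverse \<open>g\<close> carries the problem for
  \<open>\<Phi>\<close> to \<open>\<Phi> (g z)\<close> on the unit disc, and the factors found there
  are composed with \<open>f\<close>.\<close>

lemma null_factorizable_simply_connected: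
  assumes "open M" "simply_connected M"
    and \<Phi>: "\<Phi> cq_holomorphic_on M"
    and null: "\<And>z. z \<in> M \<Longrightarrow> cq_symnorm (\<Phi> z) = 0"
    and nz: "\<And>z. z \<in> M \<Longrightarrow> \<Phi> z \<noteq> 0"
  shows "null_factorizable_on M \<Phi>"
proof -
  consider "M = {}" | "M = UNIV" | f g where "f holomorphic_on M" "g holomorphic_on ball 0 1"
    "\<forall>z\<in>M. f z \<in> ball 0 1 \<and> g (f z) = z" "\<forall>z\<in>ball 0 1. g z \<in> M \<and> f (g z) = z"
    using assms(2) unfolding simply_connected_eq_biholomorphic_to_disc[OF \<open>open M\<close>] by blast
  then show ?thesis
  proof cases
    case 1
    have "(\<lambda>_. 1) cq_holomorphic_on M" by (rule cq_holomorphic_const)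
    with 1 show ?thesis
      unfolding null_factorizable_on_def by blast
  next
    case 2
    interpret disc_exhaustion "\<lambda>n. real n + 1" UNIV by (rule disc_exhaustion_UNIV)
    show ?thesis using null_factorizable \<Phi> null nz unfolding 2 by blast
  next
    case (3 f g)
    interpret disc_exhaustion "\<lambda>n. 1 - 1 / (real n + 2)" "ball 0 1" by (rule disc_exhaustion_unit_disc)
    have "null_factorizable_on (ball 0 1) (\<lambda>z. \<Phi> (g z))"
    proof (rule null_factorizable)
      show "(\<lambda>z. \<Phi> (g z)) cq_holomorphic_on ball 0 1"
        using 3 by (intro cq_holomorphic_compose[OF \<Phi>]) auto
    qed (use 3 null nz in auto)
    then obtain A B where AB: "A cq_holomorphic_on ball 0 1" "B cq_holomorphic_on ball 0 1"
      "\<forall>z\<in>ball 0 1. A z \<in> Sp1C \<and> B z \<in> Sp1C \<and> \<Phi> (g z) = A z * E11 * B z"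
      unfolding null_factorizable_on_def by blast
    have "(\<lambda>z. A (f z)) cq_holomorphic_on M" "(\<lambda>z. B (f z)) cq_holomorphic_on M"
      using 3(3) by (auto intro!: cq_holomorphic_compose[OF AB(1) 3(1)]
          cq_holomorphic_compose[OF AB(2) 3(1)] simp del: mem_ball)
    moreover have "\<forall>z\<in>M. A (f z) \<in> Sp1C \<and> B (f z) \<in> Sp1C \<and> \<Phi> z = A (f z) * E11 * B (f z)"
    proof
      fix z assume "z \<in> M"
      with 3(3) have "f z \<in> ball 0 1" "g (f z) = z" by blast+
      with AB(3)[rule_format, of "f z"]
      show "A (f z) \<in> Sp1C \<and> B (f z) \<in> Sp1C \<and> \<Phi> z = A (f z) * E11 * B (f z)" by simp
    qed
    ultimately show ?thesis
      unfolding null_factorizable_on_def by blast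
  qed
qed

theorem theorem3p4:
  fixes M :: "complex set" and \<Phi> :: "complex \<Rightarrow> cquat" and L0 :: cquat
  assumes "open M" and "connected M" and "simply_connected M"
    and "\<Phi> cq_holomorphic_on M"
    and "\<And>z. z \<in> M \<Longrightarrow> cq_symnorm (\<Phi> z) = 0"
    and "\<And>z. z \<in> M \<Longrightarrow> \<Phi> z \<noteq> 0"
    and "L0 \<noteq> 0" and "cq_symnorm L0 = 0"
  shows "\<exists>A B :: complex \<Rightarrow> cquat.
           A cq_holomorphic_on M \<and> B cq_holomorphic_on M \<and>
           (\<forall>z\<in>M. A z \<in> Sp1C) \<and> (\<forall>z\<in>M. B z \<in> Sp1C) \<and>
           (\<forall>z\<in>M. \<Phi> z = A z * L0 * B z)"
proof -
  \<comment> \<open>\<open>L0\<close> is treated as a constant null map on the plane; the values of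
    its factors at any one point are constants \<open>P\<close> and \<open>Q\<close> linking
    \<open>L0\<close> to \<open>E11\<close>.\<close>
  have "null_factorizable_on UNIV (\<lambda>_. L0)"
    using assms by (intro null_factorizable_simply_connected cq_holomorphic_const)
      (auto intro: convex_imp_simply_connected)
  then obtain P Q where PQ: "P \<in> Sp1C" "Q \<in> Sp1C" "L0 = P * E11 * Q"
    unfolding null_factorizable_on_def by blast
  note P = Sp1C_conj[OF PQ(1)] and Q = Sp1C_conj[OF PQ(2)]
  have "cq_conj P * L0 * cq_conj Q = (cq_conj P * P) * E11 * (Q * cq_conj Q)"
    unfolding PQ(3) by (simp only: mult.assoc)
  then have E: "E11 = cq_conj P * L0 * cq_conj Q"
    using P Q by simp
  obtain A B where AB: "A cq_holomorphic_on M" "B cq_holomorphic_on M"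
    "\<And>z. z \<in> M \<Longrightarrow> A z \<in> Sp1C" "\<And>z. z \<in> M \<Longrightarrow> B z \<in> Sp1C"
    "\<And>z. z \<in> M \<Longrightarrow> \<Phi> z = A z * E11 * B z"
    using null_factorizable_simply_connected[OF assms(1,3-6)]
    unfolding null_factorizable_on_def by blast
  show ?thesis
  proof (intro exI conjI ballI)
    show "(\<lambda>z. A z * cq_conj P) cq_holomorphic_on M" "(\<lambda>z. cq_conj Q * B z) cq_holomorphic_on M"
      by (intro cq_holomorphic_mult cq_holomorphic_const AB)+
    fix z assume z: "z \<in> M"
    show "A z * cq_conj P \<in> Sp1C" "cq_conj Q * B z \<in> Sp1C"
      by (intro Sp1C_mult P Q AB z)+
    show "\<Phi> z = A z * cq_conj P * L0 * (cq_conj Q * B z)"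
      using AB(5)[OF z] unfolding E by (simp only: mult.assoc)
  qed
qed

end
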